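(* For every integer $r\ge 2$ there exist a constant $c>0$ and an integer $v_0$ such that for every integer $v\ge v_0$ there exists a strictly $r$-sparse $4$-cycle packing of order $v$ containing at least $c\cdot v^2$ $4$-cycles.
   Context: A $4$-cycle is a cycle of length four, written $(a,b,c,d)$ with edges $\{a,b\},\{b,c\},\{c,d\},\{d,a\}$; its diagonals are the pairs $\{a,c\}$ and $\{b,d\}$. A $4$-cycle packing of order $w$ is a pair $(W,\mathcal{D})$ with $|W|=w$ and $\mathcal{D}$ a set of pairwise edge-disjoint $4$-cycles whose vertices lie in $W$. A $(k,l)$-configuration in a packing is a set of $l$ of its $4$-cycles whose union contains precisely $k$ vertices. A packing is $r$-sparse if it contains no $(j+3,j)$-configuration for any integer $j$ with $2\le j\le r$. A double-diamond configuration is a pair of $4$-cycles of the form $(a,b,c,d)$ and $(a,e,c,f)$ (six distinct vertices), i.e. two $4$-cycles sharing a common diagonal. A packing is $D$-avoiding if it contains no double-diamond configuration, and strictly $r$-sparse if it is both $r$-sparse and $D$-avoiding. *)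

theory Defs imports Complex_Main begin

text \<open>
  A 4-cycle is represented by its edge set, an edge being a two-element set of vertices.
  Thus the rotations and reflections of a tuple \<open>(a, b, c, d)\<close> denote the same cycle,
  and the vertex set of a cycle \<open>C\<close> is \<open>\<Union>C\<close>.
\<close>

definition cycle4 :: "'a \<Rightarrow> 'a \<Rightarrow> 'a \<Rightarrow> 'a \<Rightarrow> 'a set set" where
  "cycle4 a b c d = {{a, b}, {b, c}, {c, d}, {d, a}}"

definition is_cycle4 :: "'a set set \<Rightarrow> bool" where
  "is_cycle4 C \<longleftrightarrow> (\<exists>a b c d. distinct [a, b, c, d] \<and> C = cycle4 a b c d)"

definition cycle4_packing :: "nat \<Rightarrow> 'a set \<Rightarrow> 'a set set set \<Rightarrow> bool" where
  "cycle4_packing w W \<D> \<longleftrightarrow>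
     finite W \<and> card W = w \<and>
     (\<forall>C\<in>\<D>. is_cycle4 C \<and> \<Union>C \<subseteq> W) \<and>
     pairwise disjnt \<D>"

definition is_configuration :: "nat \<Rightarrow> nat \<Rightarrow> 'a set set set \<Rightarrow> 'a set set set \<Rightarrow> bool" where
  "is_configuration k l \<D> \<S> \<longleftrightarrow>
     \<S> \<subseteq> \<D> \<and> finite \<S> \<and> card \<S> = l \<and>
     finite (\<Union>C\<in>\<S>. \<Union>C) \<and> card (\<Union>C\<in>\<S>. \<Union>C) = k"

definition sparse :: "nat \<Rightarrow> 'a set set set \<Rightarrow> bool" where
  "sparse r \<D> \<longleftrightarrow> (\<forall>j. 2 \<le> j \<and> j \<le> r \<longrightarrow> \<not> (\<exists>\<S>. is_configuration (j + 3) j \<D> \<S>))"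

definition double_diamond :: "'a set set \<Rightarrow> 'a set set \<Rightarrow> bool" where
  "double_diamond C C' \<longleftrightarrow>
     (\<exists>a b c d e f. distinct [a, b, c, d, e, f] \<and> C = cycle4 a b c d \<and> C' = cycle4 a e c f)"

definition D_avoiding :: "'a set set set \<Rightarrow> bool" where
  "D_avoiding \<D> \<longleftrightarrow> \<not> (\<exists>C\<in>\<D>. \<exists>C'\<in>\<D>. double_diamond C C')"

definition strictly_sparse :: "nat \<Rightarrow> 'a set set set \<Rightarrow> bool" where
  "strictly_sparse r \<D> \<longleftrightarrow> sparse r \<D> \<and> D_avoiding \<D>"

end

theory Submission imports Defs "HOL-Library.FuncSet" begin

text \<open>
  The proof is by deletion from a random family. Choose \<open>N = (v div M)\<^sup>2\<close> four-element
  subsets of \<open>{..<v}\<close> independently and uniformly, and call a set of \<open>j\<close> indices bad if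
  \<open>2 \<le> j \<le> r\<close> and the corresponding subsets cover at most \<open>2j + 2\<close> points. The expected number
  of bad \<open>j\<close>-sets is \<open>O(N\<^sup>j v\<^bsup>2j+2\<^esup> / v\<^bsup>4j\<^esup>) = O(N / M\<^bsup>2j-2\<^esup>)\<close>, so for large \<open>M\<close> some choice
  has at most \<open>N/2\<close> bad sets, and deleting an index from each leaves at least \<open>N/2\<close> subsets of
  which every \<open>j\<close>, for \<open>2 \<le> j \<le> r\<close>, cover at least \<open>2j + 3\<close> points. As \<open>2j + 3 \<ge> j + 4\<close>,
  placing any 4-cycle on each of them gives an \<open>r\<close>-sparse family; the case \<open>j = 2\<close> says that two
  of the cycles share at most one vertex, which yields edge-disjointness and excludes double
  diamonds.
\<close>

section \<open>Counting families of subsets with a small union\<close>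

lemma card_PiE_small_union_le:
  fixes V :: "'b set" and S I :: "'a set"
  assumes "finite V" "finite I" "S \<subseteq> I" "m \<le> card V"
  shows "card {F \<in> I \<rightarrow>\<^sub>E {e. e \<subseteq> V \<and> card e = k}. card (\<Union>(F ` S)) \<le> m}
           \<le> (card V choose m) * ((m choose k) ^ card S * (card V choose k) ^ (card I - card S))"
    (is "card ?A \<le> _")
proof -
  define E where "E = (\<lambda>T::'b set. {e. e \<subseteq> T \<and> card e = k})"
  define B where "B = (\<lambda>T. PiE I (\<lambda>i. if i \<in> S then E T else E V))"
  define \<T> where "\<T> = {T. T \<subseteq> V \<and> card T = m}"
  have finE: "finite (E T)" if "T \<subseteq> V" for T
    using finite_subset[OF that \<open>finite V\<close>] by (simp add: E_def)
  have fin\<T>: "finite \<T>"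
    using \<open>finite V\<close> by (simp add: \<T>_def)
  have "?A \<subseteq> (\<Union>T\<in>\<T>. B T)"
  proof
    fix F assume F: "F \<in> ?A"
    have sub: "\<Union>(F ` S) \<subseteq> V"
      using F \<open>S \<subseteq> I\<close> by (fastforce simp: PiE_iff)
    then obtain T where T: "\<Union>(F ` S) \<subseteq> T" "T \<subseteq> V" "card T = m"
      using exists_subset_between[of "\<Union>(F ` S)" m V] F assms by auto
    have "F \<in> B T"
      using F T by (auto simp: B_def PiE_iff E_def)
    then show "F \<in> (\<Union>T\<in>\<T>. B T)"
      using T by (auto simp: \<T>_def)
  qed
  moreover have "finite (B T)" if "T \<in> \<T>" for T
    using that finE \<open>finite I\<close> by (auto simp: B_def \<T>_def intro!: finite_PiE)
  ultimately have "card ?A \<le> card (\<Union>T\<in>\<T>. B T)"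
    using fin\<T> by (intro card_mono) auto
  also have "\<dots> \<le> (\<Sum>T\<in>\<T>. card (B T))"
    by (rule card_UN_le[OF fin\<T>])
  also have "\<dots> = (\<Sum>T\<in>\<T>. (m choose k) ^ card S * (card V choose k) ^ (card I - card S))"
  proof (rule sum.cong)
    fix T assume T: "T \<in> \<T>"
    have cT: "card (E T) = m choose k"
      using T finite_subset[OF _ \<open>finite V\<close>] by (auto simp: E_def \<T>_def n_subsets)
    have cV: "card (E V) = card V choose k"
      using \<open>finite V\<close> by (simp add: E_def n_subsets)
    have "card (B T) = (\<Prod>i\<in>I. if i \<in> S then m choose k else card V choose k)"
      unfolding B_def using \<open>finite I\<close> by (simp add: card_PiE if_distrib cT cV cong: if_cong)
    also have "\<dots> = (m choose k) ^ card (I \<inter> S) * (card V choose k) ^ card (I \<inter> - S)"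
      using \<open>finite I\<close> by (simp add: prod.If_cases)
    also have "I \<inter> S = S" using \<open>S \<subseteq> I\<close> by blast
    also have "card (I \<inter> - S) = card I - card S"
      using assms by (metis Diff_eq card_Diff_subset finite_subset)
    finally show "card (B T) = (m choose k) ^ card S * (card V choose k) ^ (card I - card S)" .
  qed simp
  also have "\<dots> = (card V choose m) * ((m choose k) ^ card S * (card V choose k) ^ (card I - card S))"
    using \<open>finite V\<close> by (simp add: \<T>_def n_subsets)
  finally show ?thesis .
qed

text \<open>The last factor is the number of all families, so its coefficient bounds the probability
  that \<open>S\<close> is bad. With j = \<open>card S\<close>, choosing the covering set costs at
  most v^m, while forcing j values into it gains order v^(4j); since m = 2j + 2, the net power of v
  is -(2j - 2).\<close>

lemma fraction_small_union_le:
  fixes V :: "'b set" and S I :: "'a set"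
  assumes "finite V" "finite I" "S \<subseteq> I" "1 \<le> card S" "m = 2 * card S + 2" "m \<le> card V"
  shows "real (card {F \<in> I \<rightarrow>\<^sub>E {e. e \<subseteq> V \<and> card e = 4}. card (\<Union>(F ` S)) \<le> m})
           \<le> (4 * real m) ^ (4 * card S) / real (card V) ^ (2 * card S - 2)
              * real (card V choose 4) ^ card I"
proof -
  define v where "v = card V"
  define j where "j = card S"
  have j: "1 \<le> j" "m = 2 * j + 2" "m \<le> v" "j \<le> card I"
    using assms by (auto simp: v_def j_def card_mono)
  have "4 \<le> v" using j by linarith
  then have "(real v / 4) ^ 4 \<le> real (v choose 4)"
    using binomial_ge_n_over_k_pow_k[of 4 v, where 'a = real] by simp
  then have E: "((real v / 4) ^ 4) ^ j \<le> real (v choose 4) ^ j"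
    by (intro power_mono) auto
  have "real (card {F \<in> I \<rightarrow>\<^sub>E {e. e \<subseteq> V \<and> card e = 4}. card (\<Union>(F ` S)) \<le> m})
      \<le> real ((v choose m) * ((m choose 4) ^ j * (v choose 4) ^ (card I - j)))"
    unfolding v_def j_def of_nat_le_iff using assms by (intro card_PiE_small_union_le) auto
  also have "\<dots> \<le> real (v ^ m * ((m ^ 4) ^ j * (v choose 4) ^ (card I - j)))"
    unfolding of_nat_le_iff using j by (intro mult_mono power_mono binomial_le_pow) auto
  \<comment> \<open>Multiplying and dividing by the lower bound from \<open>E\<close> lets the
    numerator copy grow to the \<open>j\<close> missing factors of the total count.\<close>
  also have "\<dots> = (real v ^ m * (real m ^ 4) ^ j / ((real v / 4) ^ 4) ^ j)
                    * (((real v / 4) ^ 4) ^ j * real (v choose 4) ^ (card I - j))"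
    using \<open>4 \<le> v\<close> by simp
  also have "\<dots> \<le> (real v ^ m * (real m ^ 4) ^ j / ((real v / 4) ^ 4) ^ j)
                    * (real (v choose 4) ^ j * real (v choose 4) ^ (card I - j))"
    using E by (intro mult_left_mono mult_right_mono) auto
  also have "real (v choose 4) ^ j * real (v choose 4) ^ (card I - j) = real (v choose 4) ^ card I"
    using j by (simp flip: power_add)
  also have "real v ^ m * (real m ^ 4) ^ j / ((real v / 4) ^ 4) ^ j
      = (4 * real m) ^ (4 * j) / real v ^ (2 * j - 2)"
  proof -
    have "4 * j = m + (2 * j - 2)" using j by linarith
    then have "real v ^ (4 * j) = real v ^ m * real v ^ (2 * j - 2)"
      by (simp add: power_add)
    then have "real v ^ m / real v ^ (4 * j) = 1 / real v ^ (2 * j - 2)"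
      using \<open>4 \<le> v\<close> by simp
    moreover have "real v ^ m * (real m ^ 4) ^ j / ((real v / 4) ^ 4) ^ j
        = (4 * real m) ^ (4 * j) * (real v ^ m / real v ^ (4 * j))"
      by (simp only: power_mult power_divide power_mult_distrib) (simp add: field_simps)
    ultimately show ?thesis by simp
  qed
  finally show ?thesis by (simp add: v_def j_def)
qed

section \<open>Deletion of bad index sets\<close>

text \<open>Removing one chosen index from each bad set loses at most half of the indices, and no
  bad set survives whole.\<close>

lemma sparse_hypergraph_by_deletion:
  fixes F :: "'a \<Rightarrow> 'b set" and I :: "'a set"
  assumes "finite I" "2 \<le> r" and F: "\<And>i. i \<in> I \<Longrightarrow> card (F i) = 4"
    and bad: "2 * card {S. S \<subseteq> I \<and> 2 \<le> card S \<and> card S \<le> r \<and> card (\<Union>(F ` S)) \<le> 2 * card S + 2}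
                \<le> card I" (is "2 * card ?B \<le> _")
  shows "\<exists>H \<subseteq> F ` I. card I \<le> 2 * card H \<and>
           (\<forall>\<S> \<subseteq> H. 2 \<le> card \<S> \<and> card \<S> \<le> r \<longrightarrow> 2 * card \<S> + 3 \<le> card (\<Union>\<S>))"
proof -
  have "\<exists>x. \<forall>S\<in>?B. x S \<in> S"
  proof (intro bchoice ballI)
    fix S assume "S \<in> ?B"
    then have "S \<noteq> {}" by auto
    then show "\<exists>y. y \<in> S" by blast
  qed
  then obtain x where x: "\<And>S. S \<in> ?B \<Longrightarrow> x S \<in> S" by blast
  define J where "J = I - x ` ?B"
  have finB: "finite ?B"
    by (rule finite_subset[of _ "Pow I"]) (use \<open>finite I\<close> in auto)
  have "card I - card (x ` ?B) \<le> card J"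
    unfolding J_def using finB by (intro diff_card_le_card_Diff) auto
  moreover have "card (x ` ?B) \<le> card ?B"
    using finB by (rule card_image_le)
  ultimately have cJ: "card I \<le> 2 * card J"
    using bad by linarith
  have J: "2 * card S + 3 \<le> card (\<Union>(F ` S))" if "S \<subseteq> J" "2 \<le> card S" "card S \<le> r" for S
  proof (rule ccontr)
    assume "\<not> ?thesis"
    then have "S \<in> ?B" using that by (auto simp: J_def)
    then show False using x[of S] that by (auto simp: J_def)
  qed
  \<comment> \<open>A repeated value would give a pair of indices covering 4 points instead of the
    required 7. Injectivity turns statements about index sets into statements about sets of
    blocks.\<close>
  have inj: "inj_on F J"
  proof (rule inj_onI, rule ccontr)
    fix i j assume "i \<in> J" "j \<in> J" "F i = F j" "i \<noteq> j"
    then show False using J[of "{i, j}"] F[of j] \<open>2 \<le> r\<close> by (auto simp: J_def)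
  qed
  show ?thesis
  proof (intro exI[of _ "F ` J"] conjI allI impI)
    show "F ` J \<subseteq> F ` I" by (auto simp: J_def)
    show "card I \<le> 2 * card (F ` J)" using cJ inj by (simp add: card_image)
    fix \<S> assume "\<S> \<subseteq> F ` J" and c: "2 \<le> card \<S> \<and> card \<S> \<le> r"
    then obtain S where S: "S \<subseteq> J" "\<S> = F ` S" by (meson subset_imageE)
    moreover have "card \<S> = card S"
      using S inj by (metis card_image inj_on_subset)
    ultimately show "2 * card \<S> + 3 \<le> card (\<Union>\<S>)"
      using J c by metis
  qed
qed

section \<open>First-moment argument and choice of constants\<close>

text \<open>An expectation argument in counting form: if every family had more than
  \<open>card I / 2\<close> bad sets, counting the pairs of a family and a bad set of it in two ways
  would give a contradiction.\<close>

lemma exists_few_bad_sets: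
  fixes V :: "'b set" and I :: "'a set" and r M q :: nat
  assumes "finite V" "finite I" and I: "card I = q\<^sup>2" and M: "M * q \<le> card V"
    and M_large: "2 * (r + 1) * (4 * (2 * r + 2)) ^ (4 * r) \<le> M\<^sup>2"
    and V: "4 \<le> card V" "2 * r + 2 \<le> card V"
  shows "\<exists>F \<in> I \<rightarrow>\<^sub>E {e. e \<subseteq> V \<and> card e = 4}.
           2 * card {S. S \<subseteq> I \<and> 2 \<le> card S \<and> card S \<le> r \<and> card (\<Union>(F ` S)) \<le> 2 * card S + 2}
             \<le> card I"
proof (rule ccontr)
  define \<Omega> where "\<Omega> = I \<rightarrow>\<^sub>E {e. e \<subseteq> V \<and> card e = 4}"
  define \<S> where "\<S> = {S. S \<subseteq> I \<and> 2 \<le> card S \<and> card S \<le> r}"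
  define bad where "bad = (\<lambda>F::'a \<Rightarrow> 'b set. \<lambda>S. card (\<Union>(F ` S)) \<le> 2 * card S + 2)"
  define v where "v = real (card V)"
  \<comment> \<open>The numerator of the previous bound at size \<open>r\<close>, which dominates
    those of all smaller sizes.\<close>
  define K where "K = (4 * (2 * real r + 2)) ^ (4 * r)"
  have "0 < v" using V by (simp add: v_def)
  have "1 \<le> K" unfolding K_def by (rule one_le_power) simp
  have KM: "2 * (real r + 1) * K \<le> (real M)\<^sup>2"
    using of_nat_mono[OF M_large, where 'a = real] by (simp add: K_def algebra_simps)
  have "0 < 2 * (real r + 1) * K" using \<open>1 \<le> K\<close> by (intro mult_pos_pos) auto
  with KM have "0 < (real M)\<^sup>2" by linarith
  then have "0 < M" by (cases M) auto
  have fin\<Omega>: "finite \<Omega>"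
    unfolding \<Omega>_def using assms by (intro finite_PiE) auto
  have card\<Omega>: "card \<Omega> = (card V choose 4) ^ card I"
    using assms by (simp add: \<Omega>_def card_PiE n_subsets)
  then have "0 < card \<Omega>" using V by simp
  have fin\<S>: "finite \<S>"
    unfolding \<S>_def by (rule finite_subset[of _ "Pow I"]) (use \<open>finite I\<close> in auto)
  assume "\<not> ?thesis"
  then have many: "card I < 2 * card {S\<in>\<S>. bad F S}" if "F \<in> \<Omega>" for F
    using that by (auto simp: \<Omega>_def \<S>_def bad_def conj_assoc not_le)
  have one: "real (card {F\<in>\<Omega>. bad F S}) \<le> K / v ^ (2 * card S - 2) * real (card \<Omega>)"
    if S: "S \<in> \<S>" for S
  proof -
    have "real (card {F\<in>\<Omega>. bad F S}) \<le>
        (4 * real (2 * card S + 2)) ^ (4 * card S) / v ^ (2 * card S - 2) * real (card \<Omega>)"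
      unfolding \<Omega>_def bad_def v_def card\<Omega>[unfolded \<Omega>_def] of_nat_power
      by (rule fraction_small_union_le) (use assms S in \<open>auto simp: \<S>_def\<close>)
    also have "(4 * real (2 * card S + 2)) ^ (4 * card S) \<le> (4 * real (2 * r + 2)) ^ (4 * card S)"
      using S by (intro power_mono) (auto simp: \<S>_def)
    also have "\<dots> \<le> (4 * real (2 * r + 2)) ^ (4 * r)"
      using S by (intro power_increasing) (auto simp: \<S>_def)
    also have "\<dots> = K" by (simp add: K_def algebra_simps)
    finally show ?thesis
      using \<open>0 < v\<close> by (simp add: divide_right_mono mult_right_mono)
  qed
  \<comment> \<open>Because \<open>card I\<close> is the square of \<open>q\<close>, splitting off
    one factor \<open>card I\<close> leaves q^(2j - 2), which matches the power of \<open>v\<close>.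
    The ratio q/v is at most 1/M, and j = 2 is the worst case.\<close>
  have level: "(\<Sum>S | S \<subseteq> I \<and> card S = j. K / v ^ (2 * card S - 2)) \<le> real (card I) * K / (real M)\<^sup>2"
    if "2 \<le> j" for j
  proof -
    have "(\<Sum>S | S \<subseteq> I \<and> card S = j. K / v ^ (2 * card S - 2)) = real (card I choose j) * (K / v ^ (2 * j - 2))"
      using \<open>finite I\<close> by (simp add: n_subsets)
    also have "\<dots> \<le> real (card I) ^ j * (K / v ^ (2 * j - 2))"
    proof (rule mult_right_mono)
      have "card I choose j \<le> card I ^ j"
        by (cases "j \<le> card I") (auto simp: binomial_le_pow binomial_eq_0)
      then show "real (card I choose j) \<le> real (card I) ^ j"
        by (simp flip: of_nat_power)
    qed (use \<open>0 < v\<close> \<open>1 \<le> K\<close> in auto)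
    also have "real (card I) ^ j = real (card I) * real q ^ (2 * j - 2)"
    proof -
      have "2 * j = 2 + (2 * j - 2)" using that by linarith
      then have "real q ^ (2 * j) = real q ^ 2 * real q ^ (2 * j - 2)"
        by (metis power_add)
      then show ?thesis by (simp add: I flip: power_mult)
    qed
    also have "\<dots> * (K / v ^ (2 * j - 2)) = real (card I) * K * (real q / v) ^ (2 * j - 2)"
      by (simp add: power_divide)
    also have "\<dots> \<le> real (card I) * K * (1 / real M) ^ (2 * j - 2)"
      using M \<open>0 < v\<close> \<open>0 < M\<close> \<open>1 \<le> K\<close> of_nat_mono[OF M, where 'a = real]
      by (intro mult_left_mono power_mono) (auto simp: v_def field_simps)
    also have "\<dots> \<le> real (card I) * K * (1 / real M) ^ 2"
      using that \<open>0 < M\<close> \<open>1 \<le> K\<close> by (intro mult_left_mono power_decreasing) auto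
    finally show ?thesis by (simp add: power_divide)
  qed
  have "\<S> = (\<Union>j\<in>{2..r}. {S. S \<subseteq> I \<and> card S = j})"
    by (auto simp: \<S>_def)
  then have "(\<Sum>S\<in>\<S>. K / v ^ (2 * card S - 2))
      = (\<Sum>j=2..r. \<Sum>S | S \<subseteq> I \<and> card S = j. K / v ^ (2 * card S - 2))"
    using \<open>finite I\<close> by (simp only:) (rule sum.UNION_disjoint, auto)
  also have "\<dots> \<le> (\<Sum>j=2..r. real (card I) * K / (real M)\<^sup>2)"
    using level by (intro sum_mono) auto
  \<comment> \<open>A crude count of the levels; \<open>M_large\<close> is tuned to absorb this
    factor together with \<open>K\<close> and the 2 from halving.\<close>
  also have "\<dots> \<le> (real r + 1) * (real (card I) * K / (real M)\<^sup>2)"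
    unfolding sum_constant using \<open>1 \<le> K\<close> by (intro mult_right_mono) auto
  also have "\<dots> \<le> real (card I) / 2"
  proof -
    have "(real r + 1) * (real (card I) * K / (real M)\<^sup>2)
        = real (card I) / 2 * (2 * (real r + 1) * K / (real M)\<^sup>2)"
      using \<open>0 < M\<close> by (simp add: field_simps)
    also have "\<dots> \<le> real (card I) / 2 * 1"
      using KM \<open>0 < (real M)\<^sup>2\<close> by (intro mult_left_mono) (auto simp: divide_le_eq)
    finally show ?thesis by simp
  qed
  finally have total: "(\<Sum>S\<in>\<S>. K / v ^ (2 * card S - 2)) \<le> real (card I) / 2" .
  have "real (card I) / 2 * real (card \<Omega>) = (\<Sum>F\<in>\<Omega>. real (card I) / 2)" by simp
  \<comment> \<open>The strict inequality, and with it the contradiction, needs at least one family;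
    4 \<le> \<open>card V\<close> provides it.\<close>
  also have "\<dots> < (\<Sum>F\<in>\<Omega>. real (card {S\<in>\<S>. bad F S}))"
  proof (rule sum_strict_mono)
    show "\<Omega> \<noteq> {}" using \<open>0 < card \<Omega>\<close> by auto
    show "real (card I) / 2 < real (card {S\<in>\<S>. bad F S})" if "F \<in> \<Omega>" for F
      using many[OF that] by linarith
  qed (fact fin\<Omega>)
  also have "\<dots> = (\<Sum>S\<in>\<S>. real (card {F\<in>\<Omega>. bad F S}))"
    using sum_multicount_gen[OF fin\<Omega> fin\<S>, of "\<lambda>F S. bad F S" "\<lambda>S. card {F\<in>\<Omega>. bad F S}"]
    by (simp flip: of_nat_sum)
  also have "\<dots> \<le> (\<Sum>S\<in>\<S>. K / v ^ (2 * card S - 2) * real (card \<Omega>))"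
    using one by (rule sum_mono)
  also have "\<dots> = (\<Sum>S\<in>\<S>. K / v ^ (2 * card S - 2)) * real (card \<Omega>)"
    by (simp add: sum_distrib_right)
  also have "\<dots> \<le> real (card I) / 2 * real (card \<Omega>)"
    using total by (rule mult_right_mono) simp
  finally show False by simp
qed

lemma exists_quadratic_sparse_hypergraph:
  fixes r :: nat
  assumes "2 \<le> r"
  shows "\<exists>c::real. 0 < c \<and> (\<exists>v0::nat. \<forall>v\<ge>v0. \<exists>H :: nat set set.
           (\<forall>e\<in>H. e \<subseteq> {..<v} \<and> card e = 4) \<and> c * (real v)\<^sup>2 \<le> real (card H) \<and>
           (\<forall>\<S> \<subseteq> H. 2 \<le> card \<S> \<and> card \<S> \<le> r \<longrightarrow> 2 * card \<S> + 3 \<le> card (\<Union>\<S>)))"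
proof -
  \<comment> \<open>Only the square of \<open>M\<close> has to reach this value, but taking
    \<open>M\<close> itself avoids a square root.\<close>
  define M :: nat where "M = 2 * (r + 1) * (4 * (2 * r + 2)) ^ (4 * r)"
  have "0 < M" by (simp add: M_def)
  have M2: "2 * (r + 1) * (4 * (2 * r + 2)) ^ (4 * r) \<le> M\<^sup>2"
    unfolding M_def[symmetric] by (simp add: power2_eq_square)
  show ?thesis
  \<comment> \<open>The 8 is 4 from squaring v \<le> 2Mq, times 2 from the deletion. The threshold
    gives q \<ge> 1 and room for covering sets of 2r + 2 points.\<close>
  proof (intro exI[of _ "1 / (8 * (real M)\<^sup>2)"] exI[of _ "M + 2 * r + 2"] conjI allI impI)
    show "0 < 1 / (8 * (real M)\<^sup>2)" using \<open>0 < M\<close> by simp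
    fix v assume v: "M + 2 * r + 2 \<le> v"
    define q where "q = v div M"
    define I where "I = {..<q\<^sup>2}"
    have "\<exists>F \<in> I \<rightarrow>\<^sub>E {e. e \<subseteq> {..<v} \<and> card e = 4}.
        2 * card {S. S \<subseteq> I \<and> 2 \<le> card S \<and> card S \<le> r \<and> card (\<Union>(F ` S)) \<le> 2 * card S + 2} \<le> card I"
      using v assms M2 by (intro exists_few_bad_sets[where q = q and M = M]) (auto simp: I_def q_def)
    then obtain F where F: "F \<in> I \<rightarrow>\<^sub>E {e. e \<subseteq> {..<v} \<and> card e = 4}"
      and few: "2 * card {S. S \<subseteq> I \<and> 2 \<le> card S \<and> card S \<le> r \<and> card (\<Union>(F ` S)) \<le> 2 * card S + 2}
                  \<le> card I"
      by blast
    have "card (F i) = 4" if "i \<in> I" for i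
      using F that by (auto simp: PiE_iff)
    from sparse_hypergraph_by_deletion[OF _ \<open>2 \<le> r\<close> this few]
    obtain H where H: "H \<subseteq> F ` I" "card I \<le> 2 * card H"
      "\<forall>\<S> \<subseteq> H. 2 \<le> card \<S> \<and> card \<S> \<le> r \<longrightarrow> 2 * card \<S> + 3 \<le> card (\<Union>\<S>)"
      by (auto simp: I_def)
    \<comment> \<open>With q \<ge> 1, the rounding loss of less than \<open>M\<close> in
      \<open>v div M\<close> costs only a factor 2.\<close>
    have "1 * M \<le> q * M"
      using v \<open>0 < M\<close> by (intro mult_right_mono) (auto simp: q_def Suc_le_eq div_greater_zero_iff)
    moreover have "v < q * M + M"
      using div_mult_mod_eq[of v M] mod_less_divisor[OF \<open>0 < M\<close>, of v] unfolding q_def by linarith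
    ultimately have "v \<le> 2 * (q * M)" by linarith
    then have "v \<le> 2 * M * q" by (simp add: mult_ac)
    then have "(real v)\<^sup>2 \<le> (2 * real M * real q)\<^sup>2"
      using of_nat_mono[of v "2 * M * q", where 'a = real] by (intro power_mono) auto
    also have "\<dots> = 4 * (real M)\<^sup>2 * real (card I)"
      by (simp add: I_def power_mult_distrib)
    also have "\<dots> \<le> 4 * (real M)\<^sup>2 * (2 * real (card H))"
      using of_nat_mono[OF H(2), where 'a = real] by (intro mult_left_mono) auto
    finally have "1 / (8 * (real M)\<^sup>2) * (real v)\<^sup>2 \<le> real (card H)"
      using \<open>0 < M\<close> by (simp add: field_simps)
    moreover have "\<forall>e\<in>H. e \<subseteq> {..<v} \<and> card e = 4"
      using H(1) F by (fastforce simp: PiE_iff)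
    ultimately show "\<exists>H :: nat set set.
           (\<forall>e\<in>H. e \<subseteq> {..<v} \<and> card e = 4) \<and> 1 / (8 * (real M)\<^sup>2) * (real v)\<^sup>2 \<le> real (card H) \<and>
           (\<forall>\<S> \<subseteq> H. 2 \<le> card \<S> \<and> card \<S> \<le> r \<longrightarrow> 2 * card \<S> + 3 \<le> card (\<Union>\<S>))"
      using H(3) by blast
  qed
qed

section \<open>From 4-element blocks to 4-cycles\<close>

lemma exists_cycle4_on:
  assumes "card e = 4"
  shows "\<exists>C. is_cycle4 C \<and> \<Union>C = e"
proof -
  obtain a b c d where "e = {a, b, c, d}" "distinct [a, b, c, d]"
    using assms by (auto simp: card_Suc_eq numeral_eq_Suc)
  then show ?thesis
    by (intro exI[of _ "cycle4 a b c d"]) (auto simp: is_cycle4_def cycle4_def)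
qed

lemma card_edge_cycle4:
  assumes "is_cycle4 C" "x \<in> C"
  shows "card x = 2"
proof -
  obtain a b c d where d: "distinct [a, b, c, d]" and C: "C = cycle4 a b c d"
    using assms(1) unfolding is_cycle4_def by blast
  show ?thesis
    using assms(2) d unfolding C cycle4_def by auto
qed

text \<open>One arbitrary cycle is placed on each block. The block is recovered as the vertex set of
  its cycle, so distinct blocks give distinct cycles and all vertex counts carry over.\<close>

lemma strictly_sparse_packing_of_hypergraph:
  fixes H :: "'a set set"
  assumes "finite W" "2 \<le> r" and H: "\<And>e. e \<in> H \<Longrightarrow> e \<subseteq> W \<and> card e = 4"
    and sparse: "\<And>\<S>. \<S> \<subseteq> H \<Longrightarrow> 2 \<le> card \<S> \<Longrightarrow> card \<S> \<le> r \<Longrightarrow> 2 * card \<S> + 3 \<le> card (\<Union>\<S>)"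
  shows "\<exists>\<D>. cycle4_packing (card W) W \<D> \<and> strictly_sparse r \<D> \<and> card \<D> = card H"
proof -
  have "\<exists>f. \<forall>e\<in>H. is_cycle4 (f e) \<and> \<Union>(f e) = e"
    using H exists_cycle4_on by (intro bchoice) blast
  then obtain f where f: "\<forall>e\<in>H. is_cycle4 (f e) \<and> \<Union>(f e) = e" ..
  have cyc: "is_cycle4 (f e)" and Un: "\<Union>(f e) = e" if "e \<in> H" for e
    using f that by simp_all
  have inj: "inj_on f H"
    using Un by (metis inj_onI)
  have two: "7 \<le> card (e \<union> e')" if "e \<in> H" "e' \<in> H" "e \<noteq> e'" for e e'
    using sparse[of "{e, e'}"] that \<open>2 \<le> r\<close> by simp
  have "pairwise disjnt (f ` H)"
  proof (rule pairwiseI, rule ccontr)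
    fix C C' assume "C \<in> f ` H" "C' \<in> f ` H" "C \<noteq> C'" "\<not> disjnt C C'"
    then obtain e e' x where e: "e \<in> H" "e' \<in> H" "e \<noteq> e'" "x \<in> f e" "x \<in> f e'"
      by (auto simp: disjnt_def)
    have fin: "finite e" "finite e'" using e H \<open>finite W\<close> by (meson finite_subset)+
    have "x \<subseteq> e \<inter> e'" using e Un by blast
    then have "2 \<le> card (e \<inter> e')"
      using card_edge_cycle4[OF cyc[OF e(1)] e(4)] fin by (metis card_mono finite_Int)
    \<comment> \<open>A common edge would force 4 + 4 \<ge> 7 + 2.\<close>
    then show False
      using two[OF e(1-3)] card_Un_Int[OF fin] H[OF e(1)] H[OF e(2)] by linarith
  qed
  then have "cycle4_packing (card W) W (f ` H)"
    using \<open>finite W\<close> cyc Un H by (auto simp: cycle4_packing_def)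
  moreover have "Defs.sparse r (f ` H)"
    unfolding sparse_def is_configuration_def
  proof (intro allI impI notI)
    fix j assume j: "2 \<le> j \<and> j \<le> r"
    assume "\<exists>\<S>. \<S> \<subseteq> f ` H \<and> finite \<S> \<and> card \<S> = j \<and> finite (\<Union>C\<in>\<S>. \<Union>C) \<and> card (\<Union>C\<in>\<S>. \<Union>C) = j + 3"
    then obtain \<S> where \<S>: "\<S> \<subseteq> f ` H" "card \<S> = j" "card (\<Union>C\<in>\<S>. \<Union>C) = j + 3" by blast
    then obtain \<T> where \<T>: "\<T> \<subseteq> H" "\<S> = f ` \<T>" by (meson subset_imageE)
    then have "card \<T> = j" using \<S> inj by (metis card_image inj_on_subset)
    moreover have "(\<Union>C\<in>\<S>. \<Union>C) = \<Union>\<T>" using \<T> Un by fastforce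
    \<comment> \<open>The blocks cover at least 2j + 3 points, more than j + 3.\<close>
    ultimately show False using sparse[OF \<T>(1)] \<S>(3) j by simp
  qed
  moreover have "D_avoiding (f ` H)"
    unfolding D_avoiding_def double_diamond_def
  proof clarify
    fix e e' a b c d g h
    assume e: "e \<in> H" "e' \<in> H" and dist: "distinct [a, b, c, d, g, h]"
      and C: "f e = cycle4 a b c d" "f e' = cycle4 a g c h"
    have "e = {a, b, c, d}" "e' = {a, g, c, h}"
      using Un[OF e(1)] Un[OF e(2)] C by (auto simp: cycle4_def)
    \<comment> \<open>Two distinct blocks on six points contradict \<open>two\<close>, which demands
      seven.\<close>
    then have "e \<noteq> e'" "e \<union> e' = set [a, b, c, d, g, h]" using dist by auto
    then show False
      using two[OF e] card_length[of "[a, b, c, d, g, h]"] by simp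
  qed
  ultimately show ?thesis
    using card_image[OF inj] by (auto simp: strictly_sparse_def)
qed

theorem theorem9:
  fixes r :: nat
  assumes "r \<ge> 2"
  shows "\<exists>c::real. c > 0 \<and> (\<exists>v0::nat. \<forall>v\<ge>v0.
           \<exists>(W :: nat set) \<D>. cycle4_packing v W \<D> \<and> strictly_sparse r \<D> \<and>
             real (card \<D>) \<ge> c * (real v)\<^sup>2)"
proof -
  from exists_quadratic_sparse_hypergraph[OF assms]
  obtain c :: real and v0 :: nat where "0 < c" and main: "\<And>v. v0 \<le> v \<Longrightarrow> \<exists>H :: nat set set.
           (\<forall>e\<in>H. e \<subseteq> {..<v} \<and> card e = 4) \<and> c * (real v)\<^sup>2 \<le> real (card H) \<and>
           (\<forall>\<S> \<subseteq> H. 2 \<le> card \<S> \<and> card \<S> \<le> r \<longrightarrow> 2 * card \<S> + 3 \<le> card (\<Union>\<S>))"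
    by blast
  have "\<exists>(W :: nat set) \<D>. cycle4_packing v W \<D> \<and> strictly_sparse r \<D> \<and>
             real (card \<D>) \<ge> c * (real v)\<^sup>2" if v: "v0 \<le> v" for v
  proof -
    obtain H :: "nat set set" where H: "\<And>e. e \<in> H \<Longrightarrow> e \<subseteq> {..<v} \<and> card e = 4"
      "c * (real v)\<^sup>2 \<le> real (card H)"
      "\<And>\<S>. \<S> \<subseteq> H \<Longrightarrow> 2 \<le> card \<S> \<Longrightarrow> card \<S> \<le> r \<Longrightarrow> 2 * card \<S> + 3 \<le> card (\<Union>\<S>)"
      using main[OF v] by blast
    show ?thesis
      using strictly_sparse_packing_of_hypergraph[of "{..<v}" r H] H assms
      by (metis card_lessThan finite_lessThan)
  qed
  with \<open>0 < c\<close> show ?thesis by blast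
qed

end
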